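(* For any real $r>0$ and positive integers $d$ and $m$ with $m\geq 2r$, if there exists an auxiliary function $f$ on $\mathbb{R}^d$ (for this $r$) with objective value $\left(\frac{r}{2}\right)^d f(0)$, then there exists an auxiliary function $g_m$ on $\mathbb{Z}_m^d$ with the same $r$ and objective value $\left(\frac{r}{2}\right)^d g_m(0)$, where $g_m(0)\leq f(0)$.
   Context: Fourier transform on $\mathbb{R}^d$: $\widehat f(y)=\int_{\mathbb{R}^d} f(x)e^{-2\pi i\langle x,y\rangle}\,dx$, where $\langle x,y\rangle=x_1y_1+\cdots+x_dy_d$. A function $f:\mathbb{R}^d\to\mathbb{R}$ is rapidly decreasing if $f(x)=O\left((1+|x|)^{-k}\right)$ for all positive integers $k$; it is radial if $f(x)$ depends only on $|x|$. For fixed $r>0$ and positive integer $d$, an auxiliary function on $\mathbb{R}^d$ is a radial, smooth, rapidly decreasing function $f:\mathbb{R}^d\to\mathbb{R}$ such that $f(0)>0$; $\widehat f(0)\geq 1$; $f(x)\leq 0$ for all $|x|\geq r$; and $\widehat f(y)\geq 0$ for all $y\in\mathbb{R}^d$. Its objective value is $\left(\frac r2\right)^d f(0)$. $\mathbb{Z}_m$ denotes $\mathbb{Z}/m\mathbb{Z}$, with coset representatives $x$ satisfying $-m/2<x\leq m/2$. Using these representatives, $\mathbb{Z}_m^d$ is embedded in $\mathbb{Z}^d\subset\mathbb{R}^d$, and for $x,y\in\mathbb{Z}_m^d$, $|x|$ denotes the Euclidean norm of the representative of $x$ and $\langle x,y\rangle=x_1y_1+\cdots+x_dy_d$. The discrete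 Fourier transform of $f:\mathbb{Z}_m^d\to\mathbb{R}$ is $\widehat f(y)=m^{-d/2}\sum_{x\in\mathbb{Z}_m^d} f(x)e^{-\frac{2\pi i}{m}\langle x,y\rangle}$. For fixed $r>0$ and positive integers $m,d$, an auxiliary function on $\mathbb{Z}_m^d$ is an even function $f:\mathbb{Z}_m^d\to\mathbb{R}$ such that $\widehat f(0)\geq m^{-d/2}$; $f(x)\leq 0$ for all $x\in\mathbb{Z}_m^d$ with $|x|\geq r$; and $\widehat f(y)\geq 0$ for all $y\in\mathbb{Z}_m^d$. Its objective value is $\left(\frac r2\right)^d f(0)$. *)

theory Defs
  imports "HOL-Analysis.Analysis" "HOL-Library.Complex_Order" "HOL-Number_Theory.Cong"
begin

text \<open>
  Euclidean space of dimension \<open>d\<close> is \<open>real ^ 'n\<close> with \<open>d = CARD('n)\<close>. Statements such as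
  \<open>0 \<le> z\<close> for complex \<open>z\<close> use the order of \<open>Complex_Order\<close>: \<open>w \<le> z\<close> means
  \<open>Re w \<le> Re z\<close> and \<open>Im w = Im z\<close>, so in particular \<open>0 \<le> z\<close> includes that \<open>z\<close> is real.
\<close>

definition fourier :: "(real ^ 'n \<Rightarrow> real) \<Rightarrow> real ^ 'n \<Rightarrow> complex" where
  "fourier f y = (\<integral>x. complex_of_real (f x) * exp (- 2 * pi * \<i> * complex_of_real (x \<bullet> y)) \<partial>lborel)"

definition rapidly_decreasing :: "(real ^ 'n \<Rightarrow> real) \<Rightarrow> bool" where
  "rapidly_decreasing f \<longleftrightarrow> (\<forall>k::nat. 0 < k \<longrightarrow> (\<exists>C. \<forall>x. \<bar>f x\<bar> \<le> C / (1 + norm x) ^ k))"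

definition radial :: "(real ^ 'n \<Rightarrow> real) \<Rightarrow> bool" where
  "radial f \<longleftrightarrow> (\<forall>x y. norm x = norm y \<longrightarrow> f x = f y)"

text \<open>\<open>C_k k f\<close>: all iterated directional derivatives of order up to \<open>k\<close> exist and are continuous.\<close>

primrec C_k :: "nat \<Rightarrow> (real ^ 'n \<Rightarrow> real) \<Rightarrow> bool" where
  "C_k 0 f \<longleftrightarrow> continuous_on UNIV f"
| "C_k (Suc k) f \<longleftrightarrow>
     (\<forall>x. f differentiable (at x)) \<and> (\<forall>v. C_k k (\<lambda>x. frechet_derivative f (at x) v))"

definition smooth :: "(real ^ 'n \<Rightarrow> real) \<Rightarrow> bool" where
  "smooth f \<longleftrightarrow> (\<forall>k. C_k k f)"

definition euclidean_auxiliary :: "real \<Rightarrow> (real ^ 'n \<Rightarrow> real) \<Rightarrow> bool" where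
  "euclidean_auxiliary r f \<longleftrightarrow>
     radial f \<and> smooth f \<and> rapidly_decreasing f \<and>
     f 0 > 0 \<and>
     fourier f 0 \<ge> 1 \<and>
     (\<forall>x. norm x \<ge> r \<longrightarrow> f x \<le> 0) \<and>
     (\<forall>y. fourier f y \<ge> 0)"

text \<open>
  A function on \<open>(\<int>/m\<int>)\<^sup>d\<close> is represented as a function on \<open>int ^ 'n\<close> that is constant on
  residue classes modulo \<open>m\<close>. Sums, norms and pointwise conditions refer to the
  representatives with coordinates in \<open>(-m/2, m/2]\<close>.
\<close>

definition mod_periodic :: "nat \<Rightarrow> (int ^ 'n \<Rightarrow> real) \<Rightarrow> bool" where
  "mod_periodic m g \<longleftrightarrow> (\<forall>x y. (\<forall>i. [x $ i = y $ i] (mod int m)) \<longrightarrow> g x = g y)"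

definition representatives :: "nat \<Rightarrow> (int ^ 'n) set" where
  "representatives m =
     {x. \<forall>i. - real m / 2 < real_of_int (x $ i) \<and> real_of_int (x $ i) \<le> real m / 2}"

definition int_vec_to_real :: "int ^ 'n \<Rightarrow> real ^ 'n" where
  "int_vec_to_real x = (\<chi> i. real_of_int (x $ i))"

definition discrete_fourier :: "nat \<Rightarrow> (int ^ 'n \<Rightarrow> real) \<Rightarrow> int ^ 'n \<Rightarrow> complex" where
  "discrete_fourier m g y =
     complex_of_real (real m powr (- real CARD('n) / 2)) *
     (\<Sum>x\<in>representatives m.
        complex_of_real (g x) *
        exp (- (2 * pi * \<i> / of_nat m) * complex_of_real (int_vec_to_real x \<bullet> int_vec_to_real y)))"

definition discrete_auxiliary :: "nat \<Rightarrow> real \<Rightarrow> (int ^ 'n \<Rightarrow> real) \<Rightarrow> bool" where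
  "discrete_auxiliary m r g \<longleftrightarrow>
     mod_periodic m g \<and>
     (\<forall>x. g (- x) = g x) \<and>
     discrete_fourier m g 0 \<ge> complex_of_real (real m powr (- real CARD('n) / 2)) \<and>
     (\<forall>x\<in>representatives m. norm (int_vec_to_real x) \<ge> r \<longrightarrow> g x \<le> 0) \<and>
     (\<forall>y\<in>representatives m. discrete_fourier m g y \<ge> 0)"

text \<open>The objective value of an auxiliary function, on either kind of domain.\<close>

definition objective_value :: "real \<Rightarrow> ('a::zero ^ 'n \<Rightarrow> real) \<Rightarrow> real" where
  "objective_value r f = (r / 2) ^ CARD('n) * f 0"

end

theory Submission
  imports Defs
begin

text \<open>
  The discrete function is the periodization of \<open>f\<close>: its value at \<open>x\<close> is the sum of \<open>f\<close> over all
  lattice points congruent to \<open>x\<close> modulo \<open>m\<close>. The sign conditions are inherited because the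
  representative of a residue class is a shortest vector of the class: if it has norm at least \<open>r\<close>,
  then \<open>f\<close> is nonpositive on the whole class. Likewise the nonzero lattice points
  congruent to 0 have norm at least \<open>m \<ge> r\<close>, so they contribute nonpositive terms to the value at
  the origin, which is therefore at most \<open>f 0\<close>.

  The discrete Fourier transform of the periodization at \<open>y\<close> is, up to the factor
  \<open>m powr (- d / 2)\<close>, the sum of \<open>f n * cos (2 * pi * (n \<bullet> \<xi>))\<close> over the whole lattice, where
  \<open>\<xi> = y / m\<close> (\<open>discrete_fourier_periodization\<close>). By Poisson summation this sum equals the sum of
  the transform of \<open>f\<close> over \<open>\<xi> + \<int>\<^sup>d\<close>. All those terms are nonnegative, so the sum is at least
  the single term at \<open>\<xi>\<close>, which is nonnegative, and at least 1 if \<open>\<xi> = 0\<close>.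

  This one-sided form of Poisson summation is \<open>poisson_inequality\<close>. The nonnegativity of the
  transform allows a direct proof, which tests \<open>f\<close> against powers of
  \<open>peak x = (\<Prod>b. cos (pi * (x \<bullet> b)) ^ 2)\<close>. On the one hand,
  \<open>peak ^ N\<close> is a trigonometric polynomial with nonnegative coefficients, so integrating \<open>f x * cos (2 * pi * (x \<bullet> \<xi>))\<close>
  against it gives a nonnegative combination of values of the transform, from which only the
  constant term is kept (\<open>integral_cos_power_kernel_ge\<close>). On the other hand, \<open>peak\<close> is periodic
  and attains its maximum 1 exactly on the lattice, so after normalization its powers tend to
  the sum of the point masses at the lattice points (\<open>peak_power_concentration\<close>, together with
  Tannery's theorem for the sum over the unit cells).
\<close>

section \<open>The Fourier expansion of a power of the cosine\<close>

text \<open>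
  This is the binomial theorem for \<open>((cis a + cis (- a)) / 2) ^ (2 * N)\<close>, shifted by a phase
  \<open>\<theta>\<close>. The phase lets multiplication by a power of a cosine be read as a nonnegative
  combination of frequency shifts, without leaving the reals.
\<close>
lemma cos_mult_cos_power_expansion:
  fixes \<theta> t :: real
  shows "cos \<theta> * cos (pi * t) ^ (2 * N) =
    (\<Sum>k\<le>2 * N. real (2 * N choose k) / 4 ^ N * cos (\<theta> + 2 * pi * (real k - real N) * t))"
proof -
  define a where "a = pi * t"
  have cos_a: "complex_of_real (cos a) = (cis a + cis (- a)) / 2"
    by (simp add: complex_eq_iff)
  have "complex_of_real (cos a) ^ (2 * N) = (cis a + cis (- a)) ^ (2 * N) / 4 ^ N"
    by (simp add: cos_a power_divide power_mult)
  also have "(cis a + cis (- a)) ^ (2 * N) =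
      (\<Sum>k\<le>2 * N. of_nat (2 * N choose k) * cis a ^ k * cis (- a) ^ (2 * N - k))"
    by (rule binomial_ring)
  also have "\<dots> = (\<Sum>k\<le>2 * N. of_nat (2 * N choose k) * cis (2 * (real k - real N) * a))"
  proof (rule sum.cong)
    fix k assume "k \<in> {..2 * N}"
    then have "cis a ^ k * cis (- a) ^ (2 * N - k) = cis (2 * (real k - real N) * a)"
      by (simp add: Complex.DeMoivre cis_mult of_nat_diff algebra_simps)
    then show "of_nat (2 * N choose k) * cis a ^ k * cis (- a) ^ (2 * N - k) =
        of_nat (2 * N choose k) * cis (2 * (real k - real N) * a)"
      by (simp add: mult.assoc)
  qed simp
  finally have "cis \<theta> * complex_of_real (cos a ^ (2 * N)) =
      (\<Sum>k\<le>2 * N. complex_of_real (real (2 * N choose k) / 4 ^ N) *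
        (cis \<theta> * cis (2 * (real k - real N) * a)))"
    by (simp add: sum_distrib_left sum_divide_distrib mult_ac)
  then have "Re (cis \<theta> * complex_of_real (cos a ^ (2 * N))) =
      (\<Sum>k\<le>2 * N. Re (complex_of_real (real (2 * N choose k) / 4 ^ N) *
        cis (\<theta> + 2 * (real k - real N) * a)))"
    by (simp only: Re_sum cis_mult)
  then show ?thesis
    by (simp only: Re_complex_of_real times_complex.sel Im_complex_of_real cis.sel a_def)
       (simp add: mult_ac)
qed

text \<open>
  The constant Fourier coefficient of \<open>cos (pi * t) ^ (2 * N)\<close>, which is also its mean over a
  period (\<open>integral_cos_power_period\<close>).
\<close>
definition central_weight :: "nat \<Rightarrow> real" where
  "central_weight N = real (2 * N choose N) / 4 ^ N"

lemma central_weight_pos: "central_weight N > 0"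
  by (simp add: central_weight_def)

lemma integrable_mult_bounded:
  fixes f u :: "'a::euclidean_space \<Rightarrow> real"
  assumes "integrable lborel f" "continuous_on UNIV u" "\<And>x. \<bar>u x\<bar> \<le> 1"
  shows "integrable lborel (\<lambda>x. f x * u x)"
proof (rule Bochner_Integration.integrable_bound[OF assms(1)])
  have "u \<in> borel_measurable borel"
    using assms(2) by (rule borel_measurable_continuous_onI)
  then show "(\<lambda>x. f x * u x) \<in> borel_measurable lborel"
    using assms(1) by (intro borel_measurable_times) auto
  show "AE x in lborel. norm (f x * u x) \<le> norm (f x)"
    using assms(3) by (intro AE_I2) (simp add: abs_mult mult_left_le)
qed

text \<open>
  The kernel is built up one coordinate at a time. Multiplying by the factor for the coordinate
  \<open>c\<close> replaces the integral at frequency \<open>y\<close> by a nonnegative combination of the integrals at the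
  frequencies \<open>y + (k - N) c\<close>. These are nonnegative by the induction hypothesis, so all of them
  except the one with \<open>k = N\<close> can be dropped.
\<close>
lemma integral_cos_power_kernel_ge:
  fixes f :: "'a::euclidean_space \<Rightarrow> real"
  assumes int: "integrable lborel f"
    and nonneg: "\<And>y. 0 \<le> (\<integral>x. f x * cos (2 * pi * (x \<bullet> y)) \<partial>lborel)"
    and "finite S"
  shows "central_weight N ^ card S * (\<integral>x. f x * cos (2 * pi * (x \<bullet> y)) \<partial>lborel)
    \<le> (\<integral>x. f x * (cos (2 * pi * (x \<bullet> y)) * (\<Prod>b\<in>S. cos (pi * (x \<bullet> b)) ^ (2 * N))) \<partial>lborel)"
  using \<open>finite S\<close>
proof (induction S arbitrary: y rule: finite_induct)
  case empty
  then show ?case by simp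
next
  case (insert c S)
  define J where "J y = (\<integral>x. f x * (cos (2 * pi * (x \<bullet> y)) *
    (\<Prod>b\<in>S. cos (pi * (x \<bullet> b)) ^ (2 * N))) \<partial>lborel)" for y
  define w where "w k = real (2 * N choose k) / 4 ^ N" for k
  have w_nonneg: "0 \<le> w k" for k
    by (simp add: w_def)
  define z where "z k = y + (real k - real N) *\<^sub>R c" for k :: nat
  have J_nonneg: "0 \<le> J z" for z
    using insert.IH[of z] nonneg[of z] central_weight_pos[of N] unfolding J_def
    by (meson order_trans mult_nonneg_nonneg zero_le_power less_imp_le)
  have prod_le: "\<bar>\<Prod>b\<in>S. cos (pi * (x \<bullet> b)) ^ (2 * N)\<bar> \<le> 1" for x :: 'a
    unfolding abs_prod by (intro prod_le_1) (auto simp: power_abs intro!: power_le_one)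
  have J_int: "integrable lborel (\<lambda>x. f x * (cos (2 * pi * (x \<bullet> y)) *
    (\<Prod>b\<in>S. cos (pi * (x \<bullet> b)) ^ (2 * N))))" for y
  proof (rule integrable_mult_bounded[OF int])
    show "\<bar>cos (2 * pi * (x \<bullet> y)) * (\<Prod>b\<in>S. cos (pi * (x \<bullet> b)) ^ (2 * N))\<bar> \<le> 1" for x
      using prod_le[of x] by (simp add: abs_mult mult_le_one)
  qed (intro continuous_intros)
  have "(\<integral>x. f x * (cos (2 * pi * (x \<bullet> y)) *
      (\<Prod>b\<in>insert c S. cos (pi * (x \<bullet> b)) ^ (2 * N))) \<partial>lborel)
    = (\<integral>x. (\<Sum>k\<le>2 * N. w k * (f x * (cos (2 * pi * (x \<bullet> z k)) *
        (\<Prod>b\<in>S. cos (pi * (x \<bullet> b)) ^ (2 * N))))) \<partial>lborel)"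
  proof (rule Bochner_Integration.integral_cong)
    fix x :: 'a
    have "cos (2 * pi * (x \<bullet> y)) * (\<Prod>b\<in>insert c S. cos (pi * (x \<bullet> b)) ^ (2 * N))
      = (cos (2 * pi * (x \<bullet> y)) * cos (pi * (x \<bullet> c)) ^ (2 * N)) * (\<Prod>b\<in>S. cos (pi * (x \<bullet> b)) ^ (2 * N))"
      using insert.hyps by simp
    also have "cos (2 * pi * (x \<bullet> y)) * cos (pi * (x \<bullet> c)) ^ (2 * N) =
        (\<Sum>k\<le>2 * N. w k * cos (2 * pi * (x \<bullet> z k)))"
      unfolding cos_mult_cos_power_expansion w_def z_def
      by (intro sum.cong refl arg_cong2[of _ _ _ _ "(*)"] arg_cong[of _ _ cos])
         (simp add: inner_add_right algebra_simps)
    finally show "f x * (cos (2 * pi * (x \<bullet> y)) *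
        (\<Prod>b\<in>insert c S. cos (pi * (x \<bullet> b)) ^ (2 * N)))
      = (\<Sum>k\<le>2 * N. w k * (f x * (cos (2 * pi * (x \<bullet> z k)) *
        (\<Prod>b\<in>S. cos (pi * (x \<bullet> b)) ^ (2 * N)))))"
      by (simp add: sum_distrib_left sum_distrib_right mult_ac)
  qed simp
  also have "\<dots> = (\<Sum>k\<le>2 * N. w k * J (z k))"
    unfolding J_def using J_int by (subst Bochner_Integration.integral_sum) auto
  also have "\<dots> \<ge> w N * J (z N)"
    using w_nonneg J_nonneg by (intro member_le_sum) auto
  also have "w N * J (z N) = central_weight N * J y"
    by (simp add: w_def z_def central_weight_def)
  also have "central_weight N * J y \<ge> central_weight N *
      (central_weight N ^ card S * (\<integral>x. f x * cos (2 * pi * (x \<bullet> y)) \<partial>lborel))"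
    using insert.IH[of y] central_weight_pos[of N] unfolding J_def
    by (intro mult_left_mono) auto
  finally show ?case
    using insert.hyps by (simp add: mult.assoc)
qed

section \<open>The mass of the kernel on the unit cube\<close>

text \<open>
  The cube is centred at the origin, so that the maximum of the kernel lies in its interior, and
  half-open, so that its integer translates partition the space.
\<close>
definition unit_cube :: "'a::euclidean_space set" where
  "unit_cube = {x. \<forall>b\<in>Basis. x \<bullet> b \<in> {- 1/2..<1/2}}"

lemma unit_cube_measurable [measurable]: "unit_cube \<in> sets borel"
  unfolding unit_cube_def by measurable

lemma integral_cos_power_period:
  "(LINT t:{- 1/2..<1/2}|lborel. cos (pi * t) ^ (2 * N)) = central_weight N"
proof -
  have char: "((\<lambda>t. cos (2 * pi * (real k - real N) * t)) has_integral (if k = N then 1 else 0))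
    {- 1/2..1/2}" for k
  proof (cases "k = N")
    case True
    then show ?thesis
      using has_integral_const_real[of "1::real" "- 1/2" "1/2"] by simp
  next
    case False
    define j where "j = int k - int N"
    define c where "c = 2 * pi * (real k - real N)"
    have "c \<noteq> 0" and c: "c = 2 * pi * of_int j"
      using False by (auto simp: c_def j_def)
    have "((\<lambda>t. cos (c * t)) has_integral (sin (c * (1/2)) / c - sin (c * (- 1/2)) / c)) {- 1/2..1/2}"
      using \<open>c \<noteq> 0\<close>
      by (intro fundamental_theorem_of_calculus)
         (auto simp flip: has_real_derivative_iff_has_vector_derivative
            intro!: derivative_eq_intros)
    moreover have "sin (c * (1/2)) = 0" 
      using sin_int_2pin[of j] sin_integer_2pi sin_npi_int[of j] by (simp add: c mult_ac)
    ultimately show ?thesis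
      using False by (simp add: c_def)
  qed
  have "((\<lambda>t. \<Sum>k\<le>2 * N. real (2 * N choose k) / 4 ^ N * cos (2 * pi * (real k - real N) * t))
    has_integral (\<Sum>k\<le>2 * N. real (2 * N choose k) / 4 ^ N * (if k = N then 1 else 0))) {- 1/2..1/2}"
    by (intro has_integral_sum has_integral_mult_right char) auto
  moreover have "(\<Sum>k\<le>2 * N. real (2 * N choose k) / 4 ^ N * (if k = N then 1 else 0)) =
      central_weight N"
    by (simp add: central_weight_def if_distrib sum.delta cong: if_cong)
  ultimately have "((\<lambda>t. cos (pi * t) ^ (2 * N)) has_integral central_weight N) {- 1/2..1/2}"
    using cos_mult_cos_power_expansion[of 0 _ N] by simp
  moreover have "set_integrable lborel {- 1/2..1/2} (\<lambda>t. cos (pi * t) ^ (2 * N))"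
    by (intro borel_integrable_atLeastAtMost' continuous_intros)
  ultimately have "(LINT t:{- 1/2..1/2}|lborel. cos (pi * t) ^ (2 * N)) = central_weight N"
    using set_borel_integral_eq_integral(2) integral_unique by metis
  moreover have "(LINT t:{- 1/2..<1/2}|lborel. cos (pi * t) ^ (2 * N)) =
      (LINT t:{- 1/2..1/2}|lborel. cos (pi * t) ^ (2 * N))"
    unfolding set_lebesgue_integral_def
    by (rule integral_cong_AE, measurable)
       (use AE_lborel_singleton[of "1/2::real"] in \<open>eventually_elim, auto simp: indicator_def\<close>)
  ultimately show ?thesis by simp
qed

text \<open>
  The mass of the kernel coincides with the constant in \<open>integral_cos_power_kernel_ge\<close>; hence no
  factor is lost when the kernel is normalized.
\<close>
lemma integral_cos_power_kernel_unit_cube: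
  "(LINT x:unit_cube|lborel. (\<Prod>b\<in>(Basis::'a::euclidean_space set). cos (pi * (x \<bullet> b)) ^ (2 * N)))
    = central_weight N ^ DIM('a)"
proof -
  define u where "u t = indicator {- 1/2..<1/2} t * cos (pi * t) ^ (2 * N)" for t :: real
  have u_nonneg: "0 \<le> u t" for t
    by (simp add: u_def power_mult)
  have [measurable]: "u \<in> borel_measurable borel"
    unfolding u_def by measurable
  have u_int: "integrable lborel u"
  proof -
    have "set_integrable lborel {- 1/2..<1/2} (\<lambda>t. cos (pi * t) ^ (2 * N))"
      by (rule set_integrable_subset[of _ "{- 1/2..1/2}"])
         (auto intro!: borel_integrable_atLeastAtMost' continuous_intros)
    then show ?thesis
      by (simp add: set_integrable_def u_def[abs_def])
  qed
  have "(\<integral>\<^sup>+t. u t \<partial>lborel) = ennreal (central_weight N)"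
    using nn_integral_eq_integral[OF u_int] u_nonneg integral_cos_power_period[of N]
    by (simp add: set_lebesgue_integral_def u_def[abs_def])
  then have "(\<integral>\<^sup>+x. (\<Prod>b\<in>(Basis::'a set). ennreal (u (x \<bullet> b))) \<partial>lborel) = ennreal (central_weight N ^ DIM('a))"
    using central_weight_pos[of N]
    by (subst nn_integral_lborel_prod) (auto simp: ennreal_power)
  then have "(\<integral>\<^sup>+x. ennreal (\<Prod>b\<in>(Basis::'a set). u (x \<bullet> b)) \<partial>lborel) = ennreal (central_weight N ^ DIM('a))"
    by (simp add: prod_ennreal u_nonneg)
  then have "(\<integral>x. (\<Prod>b\<in>(Basis::'a set). u (x \<bullet> b)) \<partial>lborel) = central_weight N ^ DIM('a)"
    using central_weight_pos[of N]
    by (intro integral_eq_nn_integral[THEN trans]) (auto intro!: prod_nonneg u_nonneg)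
  moreover have "(\<Prod>b\<in>(Basis::'a set). u (x \<bullet> b)) = indicator unit_cube x *
      (\<Prod>b\<in>(Basis::'a set). cos (pi * (x \<bullet> b)) ^ (2 * N))" for x
  proof (cases "x \<in> unit_cube")
    case True
    then show ?thesis by (auto simp: unit_cube_def u_def intro!: prod.cong)
  next
    case False
    then obtain b where "b \<in> Basis" "u (x \<bullet> b) = 0"
      by (auto simp: unit_cube_def u_def)
    then show ?thesis using False by (auto intro!: prod_zero)
  qed
  ultimately show ?thesis
    by (simp add: set_lebesgue_integral_def)
qed


section \<open>Concentration of powers of a peak function\<close>

lemma set_integrable_continuous_bounded:
  fixes u :: "'a::euclidean_space \<Rightarrow> real"
  assumes "continuous_on UNIV u" "compact K" "Q \<in> sets borel" "Q \<subseteq> K"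
  shows "set_integrable lborel Q u"
proof (rule set_integrable_subset)
  show "set_integrable lborel K u"
    unfolding set_integrable_def
    using assms(1,2) by (intro borel_integrable_compact) (auto intro: continuous_on_subset)
qed (use assms in auto)

text \<open>
  Away from the origin \<open>P\<close> is at most some \<open>\<rho> < 1\<close>, whereas near the origin it exceeds some
  \<open>\<sigma>\<close> between \<open>\<rho>\<close> and 1. So the total mass of \<open>P ^ N\<close> is at least a constant times \<open>\<sigma> ^ N\<close>, and
  the fraction of it that is far from the origin is at most a constant times \<open>(\<rho> / \<sigma>) ^ N\<close>.
\<close>
lemma peak_function_concentration:
  fixes P G :: "'a::euclidean_space \<Rightarrow> real"
  assumes K: "compact K" and Q: "Q \<in> sets borel" "Q \<subseteq> K" "0 \<in> interior Q"
    and P: "continuous_on UNIV P" "\<And>x. 0 \<le> P x" "P 0 = 1"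
    and peak: "\<And>x. x \<in> K \<Longrightarrow> x \<noteq> 0 \<Longrightarrow> P x < 1"
    and G: "continuous_on UNIV G"
  shows "(\<lambda>N. (LINT x:Q|lborel. G x * P x ^ N) / (LINT x:Q|lborel. P x ^ N)) \<longlonglongrightarrow> G 0"
proof (rule tendstoI)
  fix e :: real assume "e > 0"
  define c where "c N = (LINT x:Q|lborel. P x ^ N)" for N
  have int: "set_integrable lborel Q u" if "continuous_on UNIV u" for u :: "'a \<Rightarrow> real"
    using set_integrable_continuous_bounded[OF that K Q(1,2)] .
  have "isCont G 0" "isCont P 0"
    using G P(1) by (auto simp: continuous_on_eq_continuous_at)
  obtain \<delta> where \<delta>: "\<delta> > 0" "\<And>x. norm x < \<delta> \<Longrightarrow> \<bar>G x - G 0\<bar> < e / 2"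
    using \<open>isCont G 0\<close> \<open>e > 0\<close> unfolding continuous_at_eps_delta
    by (metis diff_zero dist_norm half_gt_zero real_norm_def)
  have "compact (G ` K)"
    using K G by (intro compact_continuous_image) (auto intro: continuous_on_subset)
  then have "bounded (G ` K)"
    by (rule compact_imp_bounded)
  then obtain B0 where B0: "\<And>x. x \<in> K \<Longrightarrow> \<bar>G x\<bar> \<le> B0"
    by (auto simp: bounded_iff)
  define B where "B = B0 + \<bar>G 0\<bar>"
  have B: "\<bar>G x - G 0\<bar> \<le> B" if "x \<in> K" for x
    using B0[OF that] by (simp add: B_def)
  have "0 \<in> K" using Q interior_subset by blast
  then have "B \<ge> 0" using B[of 0] by simp
  obtain \<rho> where \<rho>: "0 \<le> \<rho>" "\<rho> < 1" "\<And>x. x \<in> K \<Longrightarrow> norm x \<ge> \<delta> \<Longrightarrow> P x \<le> \<rho>"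
  proof (cases "K - ball 0 \<delta> = {}")
    case True
    then have "P x \<le> 0" if "x \<in> K" "norm x \<ge> \<delta>" for x
      using that by auto
    then show ?thesis by (intro that[of 0]) auto
  next
    case False
    have "compact (K - ball 0 \<delta>)"
      using K by (intro compact_diff) auto
    then obtain a where a: "a \<in> K - ball 0 \<delta>" "\<And>x. x \<in> K - ball 0 \<delta> \<Longrightarrow> P x \<le> P a"
      using continuous_attains_sup[of "K - ball 0 \<delta>" P] False P(1)
      by (metis continuous_on_subset subset_UNIV)
    have "P a < 1"
      using a(1) \<delta>(1) by (intro peak) auto
    then show ?thesis
      using a(2) P(2)[of a] by (intro that[of "P a"]) auto
  qed
  define \<sigma> where "\<sigma> = (\<rho> + 1) / 2"
  have \<sigma>: "0 < \<sigma>" "\<rho> < \<sigma>" "\<sigma> < 1"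
    using \<rho> by (auto simp: \<sigma>_def)
  obtain \<eta>1 where \<eta>1: "\<eta>1 > 0" "\<And>x. norm x < \<eta>1 \<Longrightarrow> \<bar>P x - 1\<bar> < 1 - \<sigma>"
    using \<open>isCont P 0\<close> \<sigma>(3) P(3) unfolding continuous_at_eps_delta
    by (metis diff_gt_0_iff_gt diff_zero dist_norm real_norm_def)
  obtain \<eta>2 where \<eta>2: "\<eta>2 > 0" "ball 0 \<eta>2 \<subseteq> Q"
    using Q(3) by (meson mem_interior)
  define \<eta> where "\<eta> = min \<eta>1 \<eta>2"
  define v where "v = measure lborel (ball (0::'a) \<eta>)"
  define V where "V = measure lborel Q"
  have "\<eta> > 0" using \<eta>1(1) \<eta>2(1) by (simp add: \<eta>_def)
  then have "v > 0" unfolding v_def by (rule content_ball_pos)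
  have \<eta>: "x \<in> Q" "P x \<ge> \<sigma>" if "x \<in> ball 0 \<eta>" for x
  proof -
    have "norm x < \<eta>1" "x \<in> ball 0 \<eta>2"
      using that by (auto simp: \<eta>_def)
    then show "x \<in> Q" "P x \<ge> \<sigma>" using \<eta>1(2)[of x] \<eta>2(2) by auto
  qed
  have c_ge: "c N \<ge> v * \<sigma> ^ N" for N
  proof -
    have "(LINT x:ball (0::'a) \<eta>|lborel. \<sigma> ^ N) = v * \<sigma> ^ N"
      by (simp add: v_def set_lebesgue_integral_def)
    moreover have "(LINT x:ball (0::'a) \<eta>|lborel. \<sigma> ^ N) \<le> c N"
      unfolding c_def set_lebesgue_integral_def
    proof (rule integral_mono)
      show "integrable lborel (\<lambda>x. indicator (ball (0::'a) \<eta>) x *\<^sub>R \<sigma> ^ N)"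
        using set_integrable_continuous_bounded[of "\<lambda>_. \<sigma> ^ N" "cball 0 \<eta>" "ball (0::'a) \<eta>"]
        by (auto simp: set_integrable_def ball_subset_cball)
      show "integrable lborel (\<lambda>x. indicator Q x *\<^sub>R P x ^ N)"
        using int[of "\<lambda>x. P x ^ N"] P(1) by (simp add: set_integrable_def continuous_on_power)
      show "indicator (ball 0 \<eta>) x *\<^sub>R \<sigma> ^ N \<le> indicator Q x *\<^sub>R P x ^ N" for x
        using \<eta>[of x] P(2)[of x] \<sigma>(1) by (auto simp: indicator_def intro: power_mono)
    qed
    ultimately show ?thesis by simp
  qed
  have c_pos: "c N > 0" for N
    using c_ge[of N] \<open>v > 0\<close> \<sigma>(1) by (meson less_le_trans mult_pos_pos zero_less_power)
  have bound: "\<bar>(LINT x:Q|lborel. G x * P x ^ N) / c N - G 0\<bar> \<le> e / 2 + B * V / v * (\<rho> / \<sigma>) ^ N" for N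
  proof -
    have "(LINT x:Q|lborel. G x * P x ^ N) - G 0 * c N = (LINT x:Q|lborel. (G x - G 0) * P x ^ N)"
      unfolding c_def set_integral_mult_right[symmetric] left_diff_distrib
      by (subst set_integral_diff) (auto intro!: int continuous_intros P(1) G)
    also have "\<bar>\<dots>\<bar> \<le> (LINT x:Q|lborel. \<bar>(G x - G 0) * P x ^ N\<bar>)"
    proof -
      have "continuous_on UNIV (\<lambda>x. (G x - G 0) * P x ^ N)"
        by (intro continuous_intros P(1) G)
      from set_integral_norm_bound[OF int[OF this]] show ?thesis
        by simp
    qed
    also have "\<dots> \<le> (LINT x:Q|lborel. e / 2 * P x ^ N + B * \<rho> ^ N)"
    proof (rule set_integral_mono)
      fix x assume "x \<in> Q"
      then have "x \<in> K" using Q(2) by auto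
      show "\<bar>(G x - G 0) * P x ^ N\<bar> \<le> e / 2 * P x ^ N + B * \<rho> ^ N"
      proof (cases "norm x < \<delta>")
        case True
        then have "\<bar>(G x - G 0) * P x ^ N\<bar> \<le> e / 2 * P x ^ N"
          unfolding abs_mult abs_of_nonneg[OF zero_le_power[OF P(2)[of x]]]
          using \<delta>(2)[of x] P(2)[of x] by (intro mult_right_mono) auto
        then show ?thesis using \<open>B \<ge> 0\<close> \<rho>(1) by (smt (verit) mult_nonneg_nonneg zero_le_power)
      next
        case False
        then have "P x ^ N \<le> \<rho> ^ N"
          using \<rho>(3)[OF \<open>x \<in> K\<close>] P(2) by (intro power_mono) auto
        then have "\<bar>(G x - G 0) * P x ^ N\<bar> \<le> B * \<rho> ^ N"
          unfolding abs_mult abs_of_nonneg[OF zero_le_power[OF P(2)[of x]]]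
          using B[OF \<open>x \<in> K\<close>] P(2)[of x] \<open>B \<ge> 0\<close> by (intro mult_mono) auto
        then show ?thesis using \<open>e > 0\<close> P(2)[of x] by (smt (verit) half_gt_zero mult_nonneg_nonneg zero_le_power)
      qed
    qed (auto intro!: int continuous_intros P(1) G)
    also have "\<dots> = e / 2 * c N + B * V * \<rho> ^ N"
    proof -
      have "(LINT x:Q|lborel. B * \<rho> ^ N) = B * V * \<rho> ^ N"
        by (simp add: V_def set_lebesgue_integral_def)
      then show ?thesis
        unfolding c_def by (subst set_integral_add) (auto intro!: int continuous_intros P(1))
    qed
    finally have "\<bar>(LINT x:Q|lborel. G x * P x ^ N) - G 0 * c N\<bar> \<le> e / 2 * c N + B * V * \<rho> ^ N" .
    then have "\<bar>(LINT x:Q|lborel. G x * P x ^ N) - G 0 * c N\<bar> / c N \<le> (e / 2 * c N + B * V * \<rho> ^ N) / c N"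
      using c_pos[of N] by (intro divide_right_mono) auto
    also have "\<bar>(LINT x:Q|lborel. G x * P x ^ N) - G 0 * c N\<bar> / c N =
        \<bar>(LINT x:Q|lborel. G x * P x ^ N) / c N - G 0\<bar>"
    proof -
      have "(LINT x:Q|lborel. G x * P x ^ N) / c N - G 0 = ((LINT x:Q|lborel. G x * P x ^ N) - G 0 * c N) / c N"
        using c_pos[of N] by (simp add: diff_divide_distrib)
      then show ?thesis
        using c_pos[of N] by (simp add: abs_divide)
    qed
    also have "(e / 2 * c N + B * V * \<rho> ^ N) / c N = e / 2 + B * V * \<rho> ^ N / c N"
      using c_pos[of N] by (simp add: field_simps)
    also have "\<dots> \<le> e / 2 + B * V * \<rho> ^ N / (v * \<sigma> ^ N)"
      using c_ge[of N] c_pos[of N] \<open>v > 0\<close> \<sigma>(1) \<open>B \<ge> 0\<close> \<rho>(1)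
      by (intro add_left_mono divide_left_mono) (auto simp: V_def)
    finally show ?thesis by (simp add: power_divide)
  qed
  have "(\<lambda>N. e / 2 + B * V / v * (\<rho> / \<sigma>) ^ N) \<longlonglongrightarrow> e / 2 + B * V / v * 0"
    using \<rho>(1) \<sigma> by (intro tendsto_intros LIMSEQ_power_zero) auto
  then have "\<forall>\<^sub>F N in sequentially. e / 2 + B * V / v * (\<rho> / \<sigma>) ^ N < e"
    by (rule order_tendstoD(2)) (use \<open>e > 0\<close> in simp)
  then show "\<forall>\<^sub>F N in sequentially.
      dist ((LINT x:Q|lborel. G x * P x ^ N) / (LINT x:Q|lborel. P x ^ N)) (G 0) < e"
    unfolding dist_real_def c_def[symmetric]
    by eventually_elim (rule le_less_trans[OF bound])
qed


section \<open>Sums over the integer lattice\<close>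

lemma int_vec_to_real_nth [simp]: "int_vec_to_real n $ i = real_of_int (n $ i)"
  by (simp add: int_vec_to_real_def)

lemma mem_unit_cube_vec: "(x :: real ^ 'n) \<in> unit_cube \<longleftrightarrow> (\<forall>i. x $ i \<in> {- 1/2..<1/2})"
  by (auto simp: unit_cube_def Basis_vec_def inner_axis)

text \<open>
  A summable majorant that is a product over the coordinates, so that its summability reduces to
  dimension one. The factor 4 pays for replacing a lattice point by another point of
  its cell.
\<close>
definition lattice_weight :: "int ^ 'n \<Rightarrow> real" where
  "lattice_weight n = (\<Prod>i\<in>UNIV. 4 / (1 + \<bar>real_of_int (n $ i)\<bar>)\<^sup>2)"

lemma lattice_weight_nonneg: "0 \<le> lattice_weight n"
  by (simp add: lattice_weight_def prod_nonneg)

lemma summable_on_int_inverse_squares: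
  "(\<lambda>k. 4 / (1 + \<bar>real_of_int k\<bar>)\<^sup>2) summable_on UNIV"
proof -
  let ?u = "\<lambda>k. 4 / (1 + \<bar>real_of_int k\<bar>)\<^sup>2"
  have "summable (\<lambda>n. inverse (real (Suc n) ^ 2))"
    using inverse_power_summable[of 2, where 'a = real] summable_Suc_iff[of "\<lambda>n. inverse (real n ^ 2)"]
    by simp
  then have "summable (\<lambda>n. 4 * inverse (real (Suc n) ^ 2))"
    by (rule summable_mult)
  then have nat: "(\<lambda>n. 4 / (1 + real n)\<^sup>2) summable_on UNIV"
    by (subst summable_on_UNIV_nonneg_real_iff) (simp_all add: field_simps)
  have "?u summable_on range int"
    by (subst summable_on_reindex) (use nat in \<open>simp_all add: o_def\<close>)
  moreover have "?u summable_on range (\<lambda>n. - int n)"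
    by (subst summable_on_reindex) (use nat in \<open>simp_all add: o_def inj_def\<close>)
  ultimately have "?u summable_on (range int \<union> range (\<lambda>n. - int n))"
    by (rule summable_on_union)
  moreover have "range int \<union> range (\<lambda>n. - int n) = UNIV"
  proof (intro set_eqI iffI UNIV_I)
    fix k :: int
    show "k \<in> range int \<union> range (\<lambda>n. - int n)"
      by (cases k rule: int_cases2) auto
  qed
  ultimately show ?thesis by simp
qed

lemma lattice_weight_summable: "lattice_weight summable_on (UNIV :: (int ^ 'n) set)"
proof -
  let ?u = "\<lambda>k. 4 / (1 + \<bar>real_of_int k\<bar>)\<^sup>2"
  have "Infinite_Set_Sum.abs_summable_on ?u UNIV"
    using summable_on_int_inverse_squares by (simp flip: abs_summable_equivalent)
  then have "Infinite_Set_Sum.abs_summable_on (\<lambda>g. \<Prod>i\<in>(UNIV :: 'n set). ?u (g i)) (UNIV \<rightarrow>\<^sub>E UNIV)"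
    by (intro abs_summable_on_prod_PiE) auto
  then have "(\<lambda>g. \<Prod>i\<in>(UNIV :: 'n set). ?u (g i)) summable_on UNIV"
    by (simp flip: abs_summable_equivalent add: abs_summable_summable)
  moreover have "bij_betw vec_nth (UNIV :: (int ^ 'n) set) UNIV"
    by (rule bij_betwI[of _ _ _ vec_lambda]) auto
  ultimately show ?thesis
    unfolding lattice_weight_def[abs_def] using summable_on_reindex_bij_betw by fastforce
qed

text \<open>
  With exponent twice the dimension, \<open>(1 + norm z) ^ (2 * CARD('n))\<close> contains a factor
  \<open>(1 + norm z)\<^sup>2\<close> for each coordinate, and in a cell around \<open>n\<close> this factor is at least a quarter of
  \<open>(1 + \<bar>n $ i\<bar>)\<^sup>2\<close>.
\<close>
lemma decay_le_lattice_weight: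
  fixes f :: "real ^ 'n \<Rightarrow> real"
  assumes decay: "\<And>x. \<bar>f x\<bar> \<le> C / (1 + norm x) ^ (2 * CARD('n))"
    and x: "x \<in> unit_cube"
  shows "\<bar>f (x + int_vec_to_real n)\<bar> \<le> C * lattice_weight n"
proof -
  define z where "z = x + int_vec_to_real n"
  have "C \<ge> 0" using decay[of 0] by simp
  have coord: "(1 + \<bar>real_of_int (n $ i)\<bar>)\<^sup>2 / 4 \<le> (1 + norm z)\<^sup>2" for i
  proof -
    have "x $ i \<in> {- 1/2..<1/2}" using x by (simp add: mem_unit_cube_vec)
    then have "\<bar>x $ i\<bar> \<le> 1/2" by auto
    moreover have "real_of_int (n $ i) = z $ i - x $ i"
      by (simp add: z_def)
    then have "\<bar>real_of_int (n $ i)\<bar> \<le> \<bar>z $ i\<bar> + \<bar>x $ i\<bar>"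
      by (metis abs_triangle_ineq4)
    moreover have "0 \<le> \<bar>z $ i\<bar>"
      by simp
    ultimately have "1 + \<bar>real_of_int (n $ i)\<bar> \<le> 2 * (1 + \<bar>z $ i\<bar>)"
      unfolding distrib_left by linarith
    also have "\<dots> \<le> 2 * (1 + norm z)"
      using component_le_norm_cart[of z i] by simp
    finally have "(1 + \<bar>real_of_int (n $ i)\<bar>)\<^sup>2 \<le> (2 * (1 + norm z))\<^sup>2"
      by (intro power_mono) auto
    then show ?thesis by (simp only: power_mult_distrib) simp
  qed
  have "(\<Prod>i\<in>(UNIV :: 'n set). (1 + \<bar>real_of_int (n $ i)\<bar>)\<^sup>2 / 4) \<le> (\<Prod>i\<in>(UNIV :: 'n set). (1 + norm z)\<^sup>2)"
    by (intro prod_mono) (use coord in auto)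
  also have "\<dots> = (1 + norm z) ^ (2 * CARD('n))"
    by (simp add: power_mult)
  finally have "C / (1 + norm z) ^ (2 * CARD('n)) \<le> C / (\<Prod>i\<in>(UNIV :: 'n set). (1 + \<bar>real_of_int (n $ i)\<bar>)\<^sup>2 / 4)"
    using \<open>C \<ge> 0\<close>
    by (intro divide_left_mono) (auto intro!: prod_pos mult_pos_pos zero_less_power add_pos_nonneg)
  also have "\<dots> = C * lattice_weight n"
    by (simp add: lattice_weight_def prod_dividef)
  finally show ?thesis
    using decay[of z] by (simp add: z_def)
qed

lemma lattice_sum_summable:
  fixes f :: "real ^ 'n \<Rightarrow> real"
  assumes decay: "\<And>x. \<bar>f x\<bar> \<le> C / (1 + norm x) ^ (2 * CARD('n))"
  shows "(\<lambda>n. f (int_vec_to_real n)) summable_on UNIV"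
proof (rule abs_summable_summable, rule Infinite_Sum.abs_summable_on_comparison_test')
  show "(\<lambda>n :: int ^ 'n. C * lattice_weight n) summable_on UNIV"
    by (intro summable_on_cmult_right lattice_weight_summable)
  show "norm (f (int_vec_to_real n)) \<le> C * lattice_weight n" for n
    using decay_le_lattice_weight[OF decay, of 0 n] by (simp add: mem_unit_cube_vec)
qed

lemma integral_eq_suminf_unit_cubes:
  fixes \<phi> :: "real ^ 'n \<Rightarrow> real" and e :: "nat \<Rightarrow> int ^ 'n"
  assumes int: "integrable lborel \<phi>" and e: "bij e"
  shows "(\<integral>x. \<phi> x \<partial>lborel) = (\<Sum>j. LINT x:unit_cube|lborel. \<phi> (x + int_vec_to_real (e j)))"
proof -
  define A where "A j = {x. x - int_vec_to_real (e j) \<in> unit_cube}" for j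
  \<comment> \<open>A point lies in the cell of the lattice vector obtained by rounding each of its coordinates.\<close>
  have in_A: "x \<in> A j \<longleftrightarrow> e j = (\<chi> i. \<lfloor>x $ i + 1/2\<rfloor>)" for x j
  proof -
    have "(x - int_vec_to_real (e j)) $ i \<in> {- 1/2..<1/2} \<longleftrightarrow> e j $ i = \<lfloor>x $ i + 1/2\<rfloor>" for i
      by (simp add: eq_commute[of "e j $ i"] floor_eq_iff) linarith
    then show ?thesis
      by (simp only: A_def mem_Collect_eq mem_unit_cube_vec vec_eq_iff vec_lambda_beta)
  qed
  have A_meas: "A j \<in> sets lborel" for j
  proof -
    have "(\<lambda>x :: real ^ 'n. x - int_vec_to_real (e j)) \<in> borel_measurable borel"
      by simp
    from measurable_sets[OF this unit_cube_measurable] show ?thesis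
      by (simp add: A_def vimage_def)
  qed
  have "(\<Union>j. A j) = UNIV"
  proof -
    have "\<exists>j. x \<in> A j" for x
      unfolding in_A using e by (metis bij_pointE)
    then show ?thesis by blast
  qed
  moreover have "A i \<inter> A j = {}" if "i \<noteq> j" for i j
  proof -
    have "e i \<noteq> e j"
      using e that by (auto simp: bij_def dest: injD)
    then show ?thesis
      by (auto simp: in_A)
  qed
  ultimately have "(\<integral>x. \<phi> x \<partial>lborel) = (\<Sum>j. LINT x:A j|lborel. \<phi> x)"
    using lebesgue_integral_countable_add[of A lborel \<phi>] A_meas int
    by (simp add: set_integrable_def set_lebesgue_integral_def)
  moreover have "(LINT x:A j|lborel. \<phi> x) = (LINT x:unit_cube|lborel. \<phi> (x + int_vec_to_real (e j)))" for j
  proof -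
    let ?c = "int_vec_to_real (e j)"
    have [measurable]: "\<phi> \<in> borel_measurable borel"
      using int by simp
    have [measurable]: "A j \<in> sets borel"
      using A_meas by simp
    have "(LINT x:A j|lborel. \<phi> x) = (\<integral>x. indicator (A j) x *\<^sub>R \<phi> x \<partial>distr lborel borel ((+) ?c))"
      by (simp add: lborel_distr_plus set_lebesgue_integral_def)
    also have "\<dots> = (\<integral>x. indicator (A j) (?c + x) *\<^sub>R \<phi> (?c + x) \<partial>lborel)"
      by (rule integral_distr) measurable
    also have "\<dots> = (LINT x:unit_cube|lborel. \<phi> (x + ?c))"
      by (simp add: set_lebesgue_integral_def A_def indicator_def add.commute)
    finally show ?thesis .
  qed
  ultimately show ?thesis
    by simp
qed

section \<open>The Poisson inequality\<close>

definition peak :: "'a::euclidean_space \<Rightarrow> real" where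
  "peak x = (\<Prod>b\<in>Basis. cos (pi * (x \<bullet> b)) ^ 2)"

lemma peak_power: "peak x ^ N = (\<Prod>b\<in>Basis. cos (pi * (x \<bullet> b)) ^ (2 * N))"
  by (simp add: peak_def prod_power_distrib power_mult)

lemma peak_nonneg: "0 \<le> peak x"
  by (simp add: peak_def prod_nonneg)

lemma continuous_peak: "continuous_on UNIV peak"
  unfolding peak_def by (intro continuous_intros)

lemma peak_periodic: "peak (x + int_vec_to_real n) = peak x"
proof -
  have "cos (pi * (t + of_int k)) ^ 2 = cos (pi * t) ^ 2" for t :: real and k
    by (simp add: distrib_left cos_add sin_npi_int cos_npi_int power_mult_distrib)
  then show ?thesis
    unfolding peak_def
    by (intro prod.cong refl) (auto simp: Basis_vec_def inner_axis inner_add_left)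
qed

lemma peak_less_1:
  fixes x :: "'a::euclidean_space"
  assumes x: "\<And>b. b \<in> Basis \<Longrightarrow> \<bar>x \<bullet> b\<bar> \<le> 1/2" and "x \<noteq> 0"
  shows "peak x < 1"
proof -
  obtain b where b: "b \<in> Basis" "x \<bullet> b \<noteq> 0"
    using \<open>x \<noteq> 0\<close> euclidean_eq_iff[of x 0] by auto
  define t where "t = \<bar>x \<bullet> b\<bar>"
  have "0 < t" "t < 1" using b x[OF b(1)] by (auto simp: t_def)
  then have "sin (pi * t) > 0"
    by (intro sin_gt_zero) auto
  moreover have "cos (pi * (x \<bullet> b)) = cos (pi * t)"
    by (simp add: t_def abs_if)
  ultimately have less: "cos (pi * (x \<bullet> b)) ^ 2 < 1"
    by (simp add: cos_squared_eq)
  have "peak x = cos (pi * (x \<bullet> b)) ^ 2 * (\<Prod>c\<in>Basis - {b}. cos (pi * (x \<bullet> c)) ^ 2)"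
    unfolding peak_def using b(1) by (intro prod.remove) auto
  also have "\<dots> \<le> cos (pi * (x \<bullet> b)) ^ 2"
    by (intro mult_left_le prod_le_1) (auto simp: abs_square_le_1)
  finally show ?thesis using less by simp
qed

lemma integral_peak_power:
  "(LINT x:(unit_cube :: 'a::euclidean_space set)|lborel. peak x ^ N) = central_weight N ^ DIM('a)"
  unfolding peak_power by (rule integral_cos_power_kernel_unit_cube)

lemma unit_cube_subset_cbox: "(unit_cube :: 'a::euclidean_space set) \<subseteq> cbox (- (1/2) *\<^sub>R One) ((1/2) *\<^sub>R One)"
proof
  fix x :: 'a assume x: "x \<in> unit_cube"
  have "- (1/2) \<le> x \<bullet> b \<and> x \<bullet> b \<le> 1/2" if "b \<in> Basis" for b
    using bspec[OF x[unfolded unit_cube_def mem_Collect_eq] that] by simp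
  then show "x \<in> cbox (- (1/2) *\<^sub>R One) ((1/2) *\<^sub>R One)"
    by (simp add: mem_box)
qed

lemma zero_in_interior_unit_cube: "0 \<in> interior (unit_cube :: 'a::euclidean_space set)"
proof (rule interiorI)
  show "box (- (1/2) *\<^sub>R One) ((1/2) *\<^sub>R One) \<subseteq> (unit_cube :: 'a set)"
  proof
    fix x :: 'a assume x: "x \<in> box (- (1/2) *\<^sub>R One) ((1/2) *\<^sub>R One)"
    have "- (1/2) < x \<bullet> b \<and> x \<bullet> b < 1/2" if "b \<in> Basis" for b
      using bspec[OF x[unfolded mem_box] that] that by simp
    then show "x \<in> unit_cube"
      by (auto simp: unit_cube_def intro: less_imp_le)
  qed
qed (auto simp: mem_box)

lemma unit_cube_set_integrable:
  fixes u :: "'a::euclidean_space \<Rightarrow> real"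
  assumes "continuous_on UNIV u"
  shows "set_integrable lborel unit_cube u"
  using set_integrable_continuous_bounded[OF assms compact_cbox _ unit_cube_subset_cbox] by simp

lemma peak_power_concentration:
  fixes G :: "'a::euclidean_space \<Rightarrow> real"
  assumes "continuous_on UNIV G"
  shows "(\<lambda>N. (LINT x:unit_cube|lborel. G x * peak x ^ N) / central_weight N ^ DIM('a)) \<longlonglongrightarrow> G 0"
proof -
  have "peak x < 1" if "x \<in> cbox (- (1/2) *\<^sub>R One) ((1/2) *\<^sub>R One)" "x \<noteq> 0" for x :: 'a
    using that by (intro peak_less_1) (auto simp: mem_box abs_le_iff)
  then show ?thesis
    unfolding integral_peak_power[symmetric]
    by (intro peak_function_concentration[OF compact_cbox _ unit_cube_subset_cbox
          zero_in_interior_unit_cube continuous_peak peak_nonneg _ _ assms])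
       (auto simp: peak_def)
qed

text \<open>
  Integrate \<open>h x = f x * cos (2 * pi * (x \<bullet> y))\<close> against the normalized kernel. The result is
  at least the integral of \<open>h\<close> for every \<open>N\<close>. Cut into unit cells, it is a series whose terms
  tend to the values of \<open>h\<close> at the lattice points and are dominated by the lattice weight, so
  the limit may be taken termwise.
\<close>
theorem poisson_inequality:
  fixes f :: "real ^ 'n \<Rightarrow> real"
  assumes cont: "continuous_on UNIV f" and int: "integrable lborel f"
    and decay: "\<And>x. \<bar>f x\<bar> \<le> C / (1 + norm x) ^ (2 * CARD('n))"
    and nonneg: "\<And>y. 0 \<le> (\<integral>x. f x * cos (2 * pi * (x \<bullet> y)) \<partial>lborel)"
  shows "(\<integral>x. f x * cos (2 * pi * (x \<bullet> y)) \<partial>lborel)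
    \<le> (\<Sum>\<^sub>\<infinity>n. f (int_vec_to_real n) * cos (2 * pi * (int_vec_to_real n \<bullet> y)))"
proof -
  define h where "h x = f x * cos (2 * pi * (x \<bullet> y))" for x
  have h_cont: "continuous_on UNIV h"
    unfolding h_def by (intro continuous_intros cont)
  have h_le: "\<bar>h x\<bar> \<le> \<bar>f x\<bar>" for x
    by (simp add: h_def abs_mult mult_left_le)
  have h_decay: "\<bar>h x\<bar> \<le> C / (1 + norm x) ^ (2 * CARD('n))" for x
    using h_le decay by (rule order_trans)
  have "infinite (UNIV :: (int ^ 'n) set)"
  proof
    assume "finite (UNIV :: (int ^ 'n) set)"
    moreover have "inj (\<lambda>k. (\<chi> i. k) :: int ^ 'n)"
      by (auto simp: inj_def vec_eq_iff)
    ultimately have "finite (UNIV :: int set)"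
      by (metis finite_imageD finite_subset subset_UNIV)
    then show False by simp
  qed
  then have e: "bij (from_nat_into (UNIV :: (int ^ 'n) set))"
    by (intro bij_betw_from_nat_into) auto
  define e where "e = from_nat_into (UNIV :: (int ^ 'n) set)"
  have "bij e" using e by (simp add: e_def)
  define I where "I k N = (LINT x:unit_cube|lborel. h (x + int_vec_to_real (e k)) * peak x ^ N)" for k N
  define w where "w N = central_weight N ^ CARD('n)" for N
  define M where "M k = C * lattice_weight (e k)" for k
  have w_pos: "w N > 0" for N
    by (simp add: w_def central_weight_pos)
  have shift_cont: "continuous_on UNIV (\<lambda>x. h (x + int_vec_to_real (e k)))" for k
    by (rule continuous_on_compose2[OF h_cont]) (auto intro!: continuous_intros)
  have limit: "(\<lambda>N. I k N / w N) \<longlonglongrightarrow> h (int_vec_to_real (e k))" for k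
    using peak_power_concentration[OF shift_cont, of k] by (simp add: I_def w_def)
  have I_le: "\<bar>I k N\<bar> \<le> M k * w N" for k N
  proof -
    have "\<bar>I k N\<bar> \<le> (LINT x:unit_cube|lborel. \<bar>h (x + int_vec_to_real (e k)) * peak x ^ N\<bar>)"
    proof -
      have "continuous_on UNIV (\<lambda>x. h (x + int_vec_to_real (e k)) * peak x ^ N)"
        by (intro continuous_intros shift_cont continuous_peak)
      from set_integral_norm_bound[OF unit_cube_set_integrable[OF this]] show ?thesis
        by (simp add: I_def)
    qed
    also have "\<dots> \<le> (LINT x:(unit_cube :: (real ^ 'n) set)|lborel. M k * peak x ^ N)"
    proof (rule set_integral_mono)
      fix x :: "real ^ 'n" assume "x \<in> unit_cube"
      then have "\<bar>h (x + int_vec_to_real (e k))\<bar> \<le> M k"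
        unfolding M_def by (rule decay_le_lattice_weight[OF h_decay])
      then show "\<bar>h (x + int_vec_to_real (e k)) * peak x ^ N\<bar> \<le> M k * peak x ^ N"
        using peak_nonneg[of x] by (auto simp: abs_mult intro!: mult_right_mono)
    qed (auto intro!: unit_cube_set_integrable continuous_intros shift_cont continuous_peak)
    also have "\<dots> = M k * w N"
      by (simp add: integral_peak_power w_def)
    finally show ?thesis .
  qed
  have M_sum: "summable M"
  proof -
    have "(\<lambda>k. lattice_weight (e k)) summable_on UNIV"
      using summable_on_reindex_bij_betw[OF \<open>bij e\<close>, of lattice_weight] lattice_weight_summable by simp
    then show ?thesis
      unfolding M_def by (intro summable_mult summable_on_imp_summable)
  qed
  have "(\<lambda>N. \<Sum>k. I k N / w N) \<longlonglongrightarrow> (\<Sum>k. h (int_vec_to_real (e k)))"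
  proof -
    have "norm (I k N / w N) \<le> M k" for k N
      using I_le[of k N] w_pos[of N] by (simp add: abs_divide field_simps)
    then have "\<forall>\<^sub>F (k, N) in at_top \<times>\<^sub>F sequentially. norm (I k N / w N) \<le> M k"
      by (intro always_eventually) auto
    from tannerys_theorem[of "\<lambda>k N. I k N / w N", OF limit this M_sum] show ?thesis
      by simp
  qed
  moreover have "(\<integral>x. h x \<partial>lborel) \<le> (\<Sum>k. I k N / w N)" for N
  proof -
    have "summable (\<lambda>k. I k N)"
      by (rule summable_comparison_test'[OF summable_mult2[OF M_sum, of "w N"], of 0]) (use I_le in auto)
    then have "(\<Sum>k. I k N / w N) = (\<Sum>k. I k N) / w N"
      by (rule suminf_divide)
    moreover have "(\<Sum>k. I k N) = (\<integral>x. h x * peak x ^ N \<partial>lborel)"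
    proof -
      have peak_le: "\<bar>cos (2 * pi * (x \<bullet> y)) * peak x ^ N\<bar> \<le> 1" for x
      proof -
        have "\<bar>peak x\<bar> \<le> 1"
          unfolding peak_def abs_prod by (intro prod_le_1) (auto simp: abs_square_le_1)
        then show ?thesis by (simp add: abs_mult power_abs mult_le_one power_le_one)
      qed
      have "integrable lborel (\<lambda>x. f x * (cos (2 * pi * (x \<bullet> y)) * peak x ^ N))"
        by (rule integrable_mult_bounded[OF int _ peak_le]) (intro continuous_intros continuous_peak)
      then have "integrable lborel (\<lambda>x. h x * peak x ^ N)"
        by (simp add: h_def mult.assoc)
      from integral_eq_suminf_unit_cubes[OF this \<open>bij e\<close>] show ?thesis
        by (simp add: I_def peak_periodic)
    qed
    moreover have "w N * (\<integral>x. h x \<partial>lborel) \<le> (\<integral>x. h x * peak x ^ N \<partial>lborel)"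
      using integral_cos_power_kernel_ge[OF int nonneg finite_Basis, of N y]
      by (simp add: h_def w_def peak_power mult.assoc)
    ultimately show ?thesis
      using w_pos[of N] by (simp add: pos_le_divide_eq mult.commute)
  qed
  ultimately have "(\<integral>x. h x \<partial>lborel) \<le> (\<Sum>k. h (int_vec_to_real (e k)))"
    by (meson LIMSEQ_le_const)
  also have "(\<Sum>k. h (int_vec_to_real (e k))) = (\<Sum>\<^sub>\<infinity>k. h (int_vec_to_real (e k)))"
  proof -
    have "(\<lambda>n. h (int_vec_to_real n)) summable_on UNIV"
      using h_decay by (rule lattice_sum_summable)
    then have "(\<lambda>k. h (int_vec_to_real (e k))) summable_on UNIV"
      using summable_on_reindex_bij_betw[OF \<open>bij e\<close>, of "\<lambda>n. h (int_vec_to_real n)"] by simp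
    then show ?thesis
      using has_sum_imp_sums[OF has_sum_infsum] sums_unique by metis
  qed
  also have "\<dots> = (\<Sum>\<^sub>\<infinity>n. h (int_vec_to_real n))"
    by (rule infsum_reindex_bij_betw[OF \<open>bij e\<close>])
  finally show ?thesis by (simp add: h_def)
qed


section \<open>Residue classes in the integer lattice\<close>

definition residue_class :: "nat \<Rightarrow> int ^ 'n \<Rightarrow> (int ^ 'n) set" where
  "residue_class m x = {k. \<forall>i. [k $ i = x $ i] (mod int m)}"

lemma mem_representatives:
  "x \<in> representatives m \<longleftrightarrow> (\<forall>i. - int m < 2 * x $ i \<and> 2 * x $ i \<le> int m)"
proof -
  have "(- real m / 2 < real_of_int t \<and> real_of_int t \<le> real m / 2) \<longleftrightarrow> (- int m < 2 * t \<and> 2 * t \<le> int m)" for t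
    by linarith
  then show ?thesis by (simp add: representatives_def)
qed

lemma finite_representatives: "finite (representatives m :: (int ^ 'n) set)"
proof (rule finite_subset)
  show "representatives m \<subseteq> vec_lambda ` (UNIV \<rightarrow>\<^sub>E {- int m..int m} :: ('n \<Rightarrow> int) set)"
  proof
    fix x :: "int ^ 'n" assume x: "x \<in> representatives m"
    have "- int m \<le> x $ i \<and> x $ i \<le> int m" for i
      using x by (auto simp: mem_representatives dest!: spec[of _ i])
    then have "vec_nth x \<in> UNIV \<rightarrow>\<^sub>E {- int m..int m}"
      by auto
    then show "x \<in> vec_lambda ` (UNIV \<rightarrow>\<^sub>E {- int m..int m})"
      by (metis image_eqI vec_nth_inverse)
  qed
qed (auto intro!: finite_imageI finite_PiE)

lemma ex_representative:
  fixes k :: "int ^ 'n"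
  assumes "m > 0"
  shows "\<exists>x\<in>representatives m. k \<in> residue_class m x"
proof -
  define x :: "int ^ 'n" where
    "x = (\<chi> i. if 2 * (k $ i mod int m) \<le> int m then k $ i mod int m else k $ i mod int m - int m)"
  have "- int m < 2 * x $ i \<and> 2 * x $ i \<le> int m" for i
  proof -
    have "0 \<le> k $ i mod int m" "k $ i mod int m < int m"
      using assms by simp_all
    then show ?thesis
      by (simp add: x_def)
  qed
  then have "x \<in> representatives m"
    by (simp add: mem_representatives)
  moreover have "k \<in> residue_class m x"
    by (simp add: residue_class_def x_def cong_def)
  ultimately show ?thesis by blast
qed

lemma abs_representative_le:
  fixes k x :: int
  assumes "- int m < 2 * x" "2 * x \<le> int m" and "[k = x] (mod int m)"
  shows "\<bar>x\<bar> \<le> \<bar>k\<bar>"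
proof (cases "k = x")
  case False
  have "int m dvd k - x"
    using assms(3) by (simp add: cong_iff_dvd_diff)
  then have "int m \<le> \<bar>k - x\<bar>"
    using False dvd_imp_le_int[of "k - x" "int m"] by simp
  then show ?thesis using assms(1,2) by linarith
qed simp

lemma norm_representative_le:
  assumes "x \<in> representatives m" "k \<in> residue_class m x"
  shows "norm (int_vec_to_real x) \<le> norm (int_vec_to_real k)"
proof (rule norm_le_componentwise_cart)
  fix i
  have "\<bar>x $ i\<bar> \<le> \<bar>k $ i\<bar>"
    using assms by (intro abs_representative_le[of m]) (auto simp: mem_representatives residue_class_def)
  then show "norm (int_vec_to_real x $ i) \<le> norm (int_vec_to_real k $ i)"
    by (simp flip: of_int_abs)
qed

lemma representative_unique:
  assumes "x \<in> representatives m" "y \<in> representatives m"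
    and "k \<in> residue_class m x" "k \<in> residue_class m y"
  shows "x = y"
proof (rule vec_eq_iff[THEN iffD2], rule allI, rule ccontr)
  fix i assume neq: "x $ i \<noteq> y $ i"
  have "[x $ i = y $ i] (mod int m)"
    using assms(3,4) by (simp add: residue_class_def cong_def)
  then have "int m \<le> \<bar>x $ i - y $ i\<bar>"
    using neq dvd_imp_le_int[of "x $ i - y $ i" "int m"] by (simp add: cong_iff_dvd_diff)
  moreover have "- int m < 2 * x $ i" "2 * x $ i \<le> int m" "- int m < 2 * y $ i" "2 * y $ i \<le> int m"
    using assms(1,2) by (auto simp: mem_representatives)
  ultimately show False by linarith
qed

lemma norm_multiple_ge:
  assumes "k \<in> residue_class m 0" "k \<noteq> 0"
  shows "real m \<le> norm (int_vec_to_real k)"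
proof -
  obtain i where i: "k $ i \<noteq> 0"
    using assms(2) by (auto simp: vec_eq_iff)
  have "int m dvd k $ i"
    using assms(1) by (simp add: residue_class_def cong_0_iff)
  then have "int m \<le> \<bar>k $ i\<bar>"
    using i dvd_imp_le_int[of "k $ i" "int m"] by simp
  then have "real m \<le> \<bar>int_vec_to_real k $ i\<bar>"
    by simp
  then show ?thesis
    using component_le_norm_cart order_trans by blast
qed

text \<open>The residue classes of the representatives partition the lattice.\<close>
lemma sum_residue_class_sums:
  fixes F :: "int ^ 'n \<Rightarrow> complex"
  assumes "m > 0" and F: "F summable_on UNIV"
  shows "(\<Sum>x\<in>representatives m. \<Sum>\<^sub>\<infinity>k\<in>residue_class m x. F k) = (\<Sum>\<^sub>\<infinity>k. F k)"
proof -
  let ?S = "Sigma (representatives m :: (int ^ 'n) set) (residue_class m)"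
  have bij: "bij_betw snd ?S UNIV"
    unfolding bij_betw_def
  proof
    show "inj_on snd ?S"
      by (rule inj_onI) (auto dest: representative_unique)
    show "snd ` ?S = UNIV"
    proof (intro set_eqI iffI UNIV_I)
      fix k :: "int ^ 'n"
      obtain x where "x \<in> representatives m" "k \<in> residue_class m x"
        using ex_representative[OF \<open>m > 0\<close>] by blast
      then show "k \<in> snd ` ?S" by force
    qed
  qed
  have "(\<lambda>p. F (snd p)) summable_on ?S"
    using summable_on_reindex_bij_betw[OF bij, of F] F by simp
  then have "(\<Sum>\<^sub>\<infinity>x\<in>representatives m. \<Sum>\<^sub>\<infinity>k\<in>residue_class m x. F k) = (\<Sum>\<^sub>\<infinity>p\<in>?S. F (snd p))"
    by (subst infsum_Sigma_banach[symmetric]) auto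
  also have "\<dots> = (\<Sum>\<^sub>\<infinity>k. F k)"
    by (rule infsum_reindex_bij_betw[OF bij])
  finally show ?thesis
    by (simp add: finite_representatives)
qed

section \<open>The periodization of an auxiliary function\<close>

lemma cis_inner_eq_exp:
  "exp (- (2 * pi * \<i> / of_nat m) * complex_of_real (int_vec_to_real k \<bullet> int_vec_to_real y)) =
    cis (- (2 * pi * (int_vec_to_real k \<bullet> ((1 / real m) *\<^sub>R int_vec_to_real y))))"
  by (simp add: cis_conv_exp mult_ac)

text \<open>
  If \<open>k\<close> and \<open>x\<close> are congruent modulo \<open>m\<close>, the two angles differ by an integer multiple of
  \<open>2 * pi\<close>.
\<close>
lemma cis_residue_class:
  assumes "m > 0" "k \<in> residue_class m x"
  shows "cis (- (2 * pi * (int_vec_to_real k \<bullet> ((1 / real m) *\<^sub>R int_vec_to_real y)))) =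
    cis (- (2 * pi * (int_vec_to_real x \<bullet> ((1 / real m) *\<^sub>R int_vec_to_real y))))"
proof -
  have "\<forall>i. \<exists>t. k $ i - x $ i = int m * t"
    using assms(2) by (auto simp: residue_class_def cong_iff_dvd_diff elim: dvdE)
  then obtain t where t: "\<And>i. k $ i - x $ i = int m * t i"
    by metis
  define q where "q = (\<Sum>i\<in>UNIV. t i * y $ i)"
  have coord: "real_of_int (k $ i) = real_of_int (x $ i) + real m * real_of_int (t i)" for i
    using t[of i] by (metis add.commute diff_add_cancel of_int_add of_int_mult of_int_of_nat_eq)
  have "int_vec_to_real k \<bullet> int_vec_to_real y = int_vec_to_real x \<bullet> int_vec_to_real y + real m * of_int q"
    by (simp add: inner_vec_def coord q_def sum_distrib_left sum.distrib[symmetric] algebra_simps)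
  then have "int_vec_to_real k \<bullet> ((1 / real m) *\<^sub>R int_vec_to_real y) =
      int_vec_to_real x \<bullet> ((1 / real m) *\<^sub>R int_vec_to_real y) + of_int q"
    using assms(1) by (simp add: field_simps)
  then have "cis (- (2 * pi * (int_vec_to_real k \<bullet> ((1 / real m) *\<^sub>R int_vec_to_real y)))) =
      cis (- (2 * pi * (int_vec_to_real x \<bullet> ((1 / real m) *\<^sub>R int_vec_to_real y)))) * cis (2 * pi * of_int (- q))"
    by (simp add: cis_mult algebra_simps)
  also have "cis (2 * pi * of_int (- q)) = 1"
    by (rule cis_multiple_2pi) simp
  finally show ?thesis by simp
qed

definition periodization :: "nat \<Rightarrow> (real ^ 'n \<Rightarrow> real) \<Rightarrow> int ^ 'n \<Rightarrow> real" where
  "periodization m f x = (\<Sum>\<^sub>\<infinity>k\<in>residue_class m x. f (int_vec_to_real k))"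

lemma infsum_reflect:
  fixes u :: "int ^ 'n \<Rightarrow> real"
  shows "(\<Sum>\<^sub>\<infinity>k. u (- k)) = (\<Sum>\<^sub>\<infinity>k. u k)"
  by (rule infsum_reindex_bij_betw) (rule bij_betwI[of _ _ _ uminus], auto)

lemma int_vec_to_real_uminus: "int_vec_to_real (- k) = - int_vec_to_real k"
  by (simp add: vec_eq_iff)

text \<open>
  The characters are constant on residue classes, so the double sum over representatives and their
  classes collapses to one sum over the lattice. The sine part is an odd function
  of the lattice point, since \<open>f\<close> is even, and its sum vanishes.
\<close>
lemma discrete_fourier_periodization:
  fixes f :: "real ^ 'n \<Rightarrow> real"
  assumes "m > 0" and even: "\<And>x. f (- x) = f x"
    and sum: "(\<lambda>k. f (int_vec_to_real k)) summable_on UNIV"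
  shows "discrete_fourier m (periodization m f) y =
    complex_of_real (real m powr (- real CARD('n) / 2) *
      (\<Sum>\<^sub>\<infinity>k. f (int_vec_to_real k) *
        cos (2 * pi * (int_vec_to_real k \<bullet> ((1 / real m) *\<^sub>R int_vec_to_real y)))))"
proof -
  define a where "a k = 2 * pi * (int_vec_to_real k \<bullet> ((1 / real m) *\<^sub>R int_vec_to_real y))" for k
  define F where "F k = complex_of_real (f (int_vec_to_real k)) * cis (- a k)" for k
  have F_sum: "F summable_on UNIV"
  proof (rule abs_summable_summable)
    show "(\<lambda>k. norm (F k)) summable_on UNIV"
      using summable_on_iff_abs_summable_on_real[THEN iffD1, OF sum] by (simp add: F_def norm_mult)
  qed
  have "complex_of_real (periodization m f x) * cis (- a x) = (\<Sum>\<^sub>\<infinity>k\<in>residue_class m x. F k)" for x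
  proof -
    have "(\<lambda>k. f (int_vec_to_real k)) summable_on residue_class m x"
      using sum by (rule summable_on_subset_banach) simp
    then have "((\<lambda>k. complex_of_real (f (int_vec_to_real k))) has_sum
        complex_of_real (periodization m f x)) (residue_class m x)"
      unfolding periodization_def by (intro has_sum_bounded_linear[OF bounded_linear_of_real] has_sum_infsum)
    then have "complex_of_real (periodization m f x) * cis (- a x) =
        (\<Sum>\<^sub>\<infinity>k\<in>residue_class m x. complex_of_real (f (int_vec_to_real k))) * cis (- a x)"
      by (simp add: infsumI)
    also have "\<dots> = (\<Sum>\<^sub>\<infinity>k\<in>residue_class m x. complex_of_real (f (int_vec_to_real k)) * cis (- a x))"
      by (rule infsum_cmult_left'[symmetric])
    also have "\<dots> = (\<Sum>\<^sub>\<infinity>k\<in>residue_class m x. F k)"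
      by (rule infsum_cong) (simp only: F_def a_def cis_residue_class[OF \<open>m > 0\<close>])
    finally show ?thesis .
  qed
  then have "(\<Sum>x\<in>representatives m. complex_of_real (periodization m f x) * cis (- a x)) = (\<Sum>\<^sub>\<infinity>k. F k)"
    using sum_residue_class_sums[OF \<open>m > 0\<close> F_sum] by simp
  moreover have "(\<Sum>\<^sub>\<infinity>k. F k) = complex_of_real (\<Sum>\<^sub>\<infinity>k. f (int_vec_to_real k) * cos (a k))"
  proof (rule complex_eqI)
    show "Re (\<Sum>\<^sub>\<infinity>k. F k) = Re (complex_of_real (\<Sum>\<^sub>\<infinity>k. f (int_vec_to_real k) * cos (a k)))"
      unfolding infsum_Re[OF F_sum, symmetric] by (simp add: F_def)
    have "(\<Sum>\<^sub>\<infinity>k. f (int_vec_to_real k) * sin (a k)) = (\<Sum>\<^sub>\<infinity>k. f (int_vec_to_real (- k)) * sin (a (- k)))"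
      by (rule infsum_reflect[symmetric])
    also have "\<dots> = - (\<Sum>\<^sub>\<infinity>k. f (int_vec_to_real k) * sin (a k))"
      by (simp add: int_vec_to_real_uminus even a_def infsum_uminus)
    finally have "(\<Sum>\<^sub>\<infinity>k. f (int_vec_to_real k) * sin (a k)) = 0"
      by simp
    then show "Im (\<Sum>\<^sub>\<infinity>k. F k) = Im (complex_of_real (\<Sum>\<^sub>\<infinity>k. f (int_vec_to_real k) * cos (a k)))"
      unfolding infsum_Im[OF F_sum, symmetric] by (simp add: F_def infsum_uminus)
  qed
  ultimately show ?thesis
    unfolding discrete_fourier_def cis_inner_eq_exp by (simp add: a_def)
qed

text \<open>The integral of a non-integrable function is 0 by convention.\<close>
lemma fourier_0_ge_1_imp_integrable:
  assumes "fourier f 0 \<ge> 1"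
  shows "integrable lborel f"
proof -
  have "fourier f 0 \<noteq> 0"
    using assms by (auto simp: less_eq_complex_def)
  then have "integrable lborel (\<lambda>x. complex_of_real (f x))"
    unfolding fourier_def using not_integrable_integral_eq by fastforce
  then show ?thesis
    by (simp add: complex_of_real_integrable_eq)
qed

lemma Re_fourier:
  fixes f :: "real ^ 'n \<Rightarrow> real"
  assumes "integrable lborel f"
  shows "Re (fourier f y) = (\<integral>x. f x * cos (2 * pi * (x \<bullet> y)) \<partial>lborel)"
proof -
  have exp_eq: "exp (- 2 * pi * \<i> * complex_of_real (x \<bullet> y)) = cis (- (2 * pi * (x \<bullet> y)))" for x
    by (simp add: cis_conv_exp mult_ac)
  have "integrable lborel (\<lambda>x. complex_of_real (f x) * cis (- (2 * pi * (x \<bullet> y))))"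
  proof (rule Bochner_Integration.integrable_bound[OF assms])
    have "(\<lambda>x. cis (- (2 * pi * (x \<bullet> y)))) \<in> borel_measurable borel"
      by (intro borel_measurable_continuous_onI continuous_intros)
    then show "(\<lambda>x. complex_of_real (f x) * cis (- (2 * pi * (x \<bullet> y)))) \<in> borel_measurable lborel"
      using assms by (intro borel_measurable_times) auto
  qed (simp add: norm_mult)
  from integral_bounded_linear[OF bounded_linear_Re this] show ?thesis
    unfolding fourier_def exp_eq by simp
qed

theorem theorem3p2:
  fixes r :: real and m :: nat and f :: "real ^ 'n \<Rightarrow> real"
  assumes "r > 0"
    and "m > 0"
    and "real m \<ge> 2 * r"
    and "euclidean_auxiliary r f"
    and "objective_value r f = (r / 2) ^ CARD('n) * f 0"
  shows "\<exists>g :: int ^ 'n \<Rightarrow> real.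
           discrete_auxiliary m r g \<and>
           objective_value r g = (r / 2) ^ CARD('n) * g 0 \<and>
           g 0 \<le> f 0"
proof -
  have radial: "radial f" and smooth: "smooth f" and rapid: "rapidly_decreasing f"
    and fourier_0: "fourier f 0 \<ge> 1" and neg: "\<And>x. norm x \<ge> r \<Longrightarrow> f x \<le> 0"
    and fourier_nonneg: "\<And>y. fourier f y \<ge> 0"
    using assms(4) by (auto simp: euclidean_auxiliary_def)
  have even: "f (- x) = f x" for x
    using radial unfolding radial_def by (metis norm_minus_cancel)
  have "C_k 0 f"
    using smooth unfolding smooth_def by blast
  then have cont: "continuous_on UNIV f"
    by simp
  have int: "integrable lborel f"
    using fourier_0 by (rule fourier_0_ge_1_imp_integrable)
  have "0 < 2 * CARD('n)"
    by simp
  then obtain C where decay: "\<And>x. \<bar>f x\<bar> \<le> C / (1 + norm x) ^ (2 * CARD('n))"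
    using rapid unfolding rapidly_decreasing_def by meson
  define g where "g = periodization m f"
  have sum: "(\<lambda>k. f (int_vec_to_real k)) summable_on UNIV"
    using decay by (rule lattice_sum_summable)
  have sum_on: "(\<lambda>k. f (int_vec_to_real k)) summable_on A" for A
    using sum by (rule summable_on_subset_banach) simp
  have cos_nonneg: "0 \<le> (\<integral>x. f x * cos (2 * pi * (x \<bullet> y)) \<partial>lborel)" for y
    using fourier_nonneg[of y] Re_fourier[OF int, of y] by (simp add: less_eq_complex_def)
  define S where "S y = (\<Sum>\<^sub>\<infinity>k. f (int_vec_to_real k) *
    cos (2 * pi * (int_vec_to_real k \<bullet> ((1 / real m) *\<^sub>R int_vec_to_real y))))" for y :: "int ^ 'n"
  have S_ge: "S y \<ge> Re (fourier f ((1 / real m) *\<^sub>R int_vec_to_real y))" for y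
    unfolding S_def Re_fourier[OF int] by (rule poisson_inequality[OF cont int decay cos_nonneg])
  have transform: "discrete_fourier m g y = complex_of_real (real m powr (- real CARD('n) / 2) * S y)" for y
    unfolding g_def S_def by (rule discrete_fourier_periodization[OF \<open>m > 0\<close> even sum])
  have "S y \<ge> 0" for y
    using S_ge[of y] fourier_nonneg[of "(1 / real m) *\<^sub>R int_vec_to_real y"]
    by (simp add: less_eq_complex_def)
  then have transform_nonneg: "discrete_fourier m g y \<ge> 0" for y
    by (simp add: transform less_eq_complex_def)
  have "int_vec_to_real (0 :: int ^ 'n) = 0"
    by (simp add: vec_eq_iff)
  then have "S 0 \<ge> 1"
    using S_ge[of 0] fourier_0 by (simp add: less_eq_complex_def)
  then have transform_0: "discrete_fourier m g 0 \<ge> complex_of_real (real m powr (- real CARD('n) / 2))"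
    by (simp add: transform less_eq_complex_def mult_le_cancel_left1)
  have "mod_periodic m g"
    unfolding mod_periodic_def
  proof (intro allI impI)
    fix x y :: "int ^ 'n" assume "\<forall>i. [x $ i = y $ i] (mod int m)"
    then have "residue_class m x = residue_class m y"
      by (auto simp: residue_class_def cong_def)
    then show "g x = g y"
      by (simp add: g_def periodization_def)
  qed
  moreover have "g (- x) = g x" for x
  proof -
    have "[- a = b] (mod int m) \<longleftrightarrow> [a = - b] (mod int m)" for a b
      using cong_minus_minus_iff[of a "- b" "int m"] by simp
    then have "bij_betw uminus (residue_class m x) (residue_class m (- x))"
      by (intro bij_betwI[of _ _ _ uminus]) (auto simp: residue_class_def)
    then have "g (- x) = (\<Sum>\<^sub>\<infinity>k\<in>residue_class m x. f (int_vec_to_real (- k)))"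
      unfolding g_def periodization_def by (rule infsum_reindex_bij_betw[symmetric])
    then show ?thesis
      by (simp add: g_def periodization_def int_vec_to_real_uminus even)
  qed
  moreover have "g x \<le> 0" if "x \<in> representatives m" "norm (int_vec_to_real x) \<ge> r" for x
  proof -
    have "f (int_vec_to_real k) \<le> 0" if "k \<in> residue_class m x" for k
      using norm_representative_le[OF \<open>x \<in> representatives m\<close> that] \<open>norm (int_vec_to_real x) \<ge> r\<close>
      by (intro neg) linarith
    then have "g x \<le> (\<Sum>\<^sub>\<infinity>k\<in>residue_class m x. 0)"
      unfolding g_def periodization_def by (intro infsum_mono sum_on) auto
    then show ?thesis by simp
  qed
  moreover have "g 0 \<le> f 0"
  proof -
    have "f (int_vec_to_real k) \<le> 0" if "k \<in> residue_class m 0" "k \<noteq> 0" for k :: "int ^ 'n"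
      using norm_multiple_ge[OF that] assms(1,3) by (intro neg) linarith
    then have "g 0 \<le> (\<Sum>\<^sub>\<infinity>k\<in>{0 :: int ^ 'n}. f (int_vec_to_real k))"
      unfolding g_def periodization_def
      by (intro infsum_mono_neutral sum_on) (auto simp: residue_class_def)
    then show ?thesis
      using \<open>int_vec_to_real (0 :: int ^ 'n) = 0\<close> by simp
  qed
  ultimately show ?thesis
    using transform_0 transform_nonneg
    by (intro exI[of _ g]) (auto simp: discrete_auxiliary_def objective_value_def)
qed

end
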